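(* Let $((A,\circ),P)$ be an averaging pre-Lie algebra, let $r\in A\otimes A$ be symmetric and $S:A\to A$ a linear map. Let $r^\sharp:A^*\to A$ be given by $r^\sharp(a^* )=\sum_i\langle a^*,a_i\rangle b_i$ for $r=\sum_ia_i\otimes b_i$. If $r^\sharp$ is a relative Rota-Baxter operator on $((A,\circ),P)$ with respect to the representation $((A^*,L^*-R^*,-R^* ),S^* )$, then $r$ is a solution of the $S$-admissible classical Yang-Baxter equation in the averaging pre-Lie algebra $((A,\circ),P)$.
   Context: All vector spaces are finite-dimensional over a fixed field $\mathbf k$ of characteristic $0$; $\langle\cdot,\cdot\rangle$ is the canonical pairing. A pre-Lie algebra $(A,\circ)$ is a vector space with a bilinear product satisfying $(x\circ y)\circ z-x\circ(y\circ z)=(y\circ x)\circ z-y\circ(x\circ z)$. Write $L(x)y=x\circ y$, $R(x)y=y\circ x$. An averaging operator is a linear $P:A\to A$ with $P(x)\circ P(y)=P(P(x)\circ y)=P(x\circ P(y))$; then $((A,\circ),P)$ is an averaging pre-Lie algebra. For linear $\rho:A\to\mathrm{End}(V)$, $\rho^*:A\to\mathrm{End}(V^* )$ is defined by $\langle\rho^*(x)v^*,v\rangle=-\langle v^*,\rho(x)v\rangle$; for a single linear map $S$, $S^*$ is the transpose $\langle S^*\xi,x\rangle=\langle\xi,S(x)\rangle$. A representation of $(A,\circ)$ is $(V,\rho,\varphi)$ with linear $\rho,\varphi:A\to\mathrm{End}(V)$ such that $\rho(x\circ y-y\circ x)=\rho(x)\rho(y)-\rho(y)\rho(x)$ and $\varphi(x\circ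 y)=\rho(x)\varphi(y)-\varphi(y)\rho(x)+\varphi(y)\varphi(x)$. A representation of $((A,\circ),P)$ is $((V,\rho,\varphi),\alpha)$ with $(V,\rho,\varphi)$ a representation of $(A,\circ)$ and $\alpha:V\to V$ linear such that $\rho(P(x))\alpha(v)=\alpha(\rho(P(x))v)=\alpha(\rho(x)\alpha(v))$ and $\varphi(P(x))\alpha(v)=\alpha(\varphi(P(x))v)=\alpha(\varphi(x)\alpha(v))$. A relative Rota-Baxter operator on $((A,\circ),P)$ with respect to $((V,\rho,\varphi),\alpha)$ is a linear map $T:V\to A$ with $T(u)\circ T(v)=T(\rho(T(u))v+\varphi(T(v))u)$ for all $u,v\in V$ and $P\circ T=T\circ\alpha$. $r=\sum_ia_i\otimes b_i\in A\otimes A$ is a solution of the $S$-admissible classical Yang-Baxter equation in $((A,\circ),P)$ if $\sum_{i,j}\bigl(a_i\otimes b_i\circ a_j\otimes b_j+a_i\otimes a_j\otimes b_i\circ b_j\bigr)=\sum_{i,j}\bigl(a_i\circ a_j\otimes b_i\otimes b_j+a_i\otimes a_j\otimes b_j\circ b_i\bigr)$, $(S\otimes\mathrm{id}-\mathrm{id}\otimes P)(r)=0$, and $(P\otimes\mathrm{id}-\mathrm{id}\otimes S)(r)=0$. *)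

theory Defs
  imports Complex_Main "HOL-Library.Function_Algebras" "HOL-Library.Poly_Mapping"
begin

section \<open>Averaging pre-Lie algebras\<close>

text \<open>An algebra lives on a whole type, with the scalar multiplication of the library locale
  \<^locale>\<open>finite_dimensional_vector_space\<close>. Bilinearity and linearity refer to that
  scalar multiplication.\<close>

locale pre_lie_algebra = finite_dimensional_vector_space scale Basis
  for scale :: "'k::field_char_0 \<Rightarrow> 'a::ab_group_add \<Rightarrow> 'a" (infixr \<open>*s\<close> 75)
    and Basis :: "'a set" +
  fixes circ :: "'a \<Rightarrow> 'a \<Rightarrow> 'a" (infixl \<open>\<cdot>\<close> 70)
  assumes linear_circ_right: "Vector_Spaces.linear scale scale (\<lambda>y. x \<cdot> y)"
    and linear_circ_left: "Vector_Spaces.linear scale scale (\<lambda>x. x \<cdot> y)"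
    and left_symmetric:
      "(x \<cdot> y) \<cdot> z - x \<cdot> (y \<cdot> z) = (y \<cdot> x) \<cdot> z - y \<cdot> (x \<cdot> z)"

locale averaging_pre_lie_algebra = pre_lie_algebra scale Basis circ
  for scale :: "'k::field_char_0 \<Rightarrow> 'a::ab_group_add \<Rightarrow> 'a" (infixr \<open>*s\<close> 75)
    and Basis and circ (infixl \<open>\<cdot>\<close> 70) +
  fixes P :: "'a \<Rightarrow> 'a"
  assumes linear_P: "Vector_Spaces.linear scale scale P"
    and averaging_left: "P x \<cdot> P y = P (P x \<cdot> y)"
    and averaging_right: "P x \<cdot> P y = P (x \<cdot> P y)"


section \<open>Representations\<close>

text \<open>The dual of an algebra is not a type of its own but a subspace of the function space
  \<^typ>\<open>'a \<Rightarrow> 'k\<close>. Representation spaces are therefore finite-dimensional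
  subspaces \<open>V\<close> of an ambient vector space, and endomorphisms of \<open>V\<close> only matter on \<open>V\<close>.\<close>

definition linear_on_space ::
    "('k::field \<Rightarrow> 'v::ab_group_add \<Rightarrow> 'v) \<Rightarrow> ('k \<Rightarrow> 'w::ab_group_add \<Rightarrow> 'w) \<Rightarrow>
     'v set \<Rightarrow> 'w set \<Rightarrow> ('v \<Rightarrow> 'w) \<Rightarrow> bool" where
  "linear_on_space sV sW V W f \<longleftrightarrow>
     f ` V \<subseteq> W \<and>
     (\<forall>u\<in>V. \<forall>v\<in>V. f (u + v) = f u + f v) \<and>
     (\<forall>c. \<forall>v\<in>V. f (sV c v) = sW c (f v))"

locale pre_lie_representation =
  pre_lie_algebra scale Basis circ + V: vector_space scaleV
  for scale :: "'k::field_char_0 \<Rightarrow> 'a::ab_group_add \<Rightarrow> 'a" (infixr \<open>*s\<close> 75)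
    and Basis and circ (infixl \<open>\<cdot>\<close> 70)
    and scaleV :: "'k \<Rightarrow> 'v::ab_group_add \<Rightarrow> 'v" +
  fixes V :: "'v set" and \<rho> \<phi> :: "'a \<Rightarrow> 'v \<Rightarrow> 'v"
  assumes finite_dimensional_V: "\<exists>B. finite B \<and> V.span B = V"
    and rho_endo: "linear_on_space scaleV scaleV V V (\<rho> x)"
    and phi_endo: "linear_on_space scaleV scaleV V V (\<phi> x)"
    and rho_linear: "v \<in> V \<Longrightarrow> Vector_Spaces.linear scale scaleV (\<lambda>x. \<rho> x v)"
    and phi_linear: "v \<in> V \<Longrightarrow> Vector_Spaces.linear scale scaleV (\<lambda>x. \<phi> x v)"
    and rho_commutator:
      "v \<in> V \<Longrightarrow> \<rho> (x \<cdot> y - y \<cdot> x) v = \<rho> x (\<rho> y v) - \<rho> y (\<rho> x v)"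
    and phi_circ:
      "v \<in> V \<Longrightarrow> \<phi> (x \<cdot> y) v = \<rho> x (\<phi> y v) - \<phi> y (\<rho> x v) + \<phi> y (\<phi> x v)"

locale averaging_representation =
  averaging_pre_lie_algebra scale Basis circ P +
  pre_lie_representation scale Basis circ scaleV V \<rho> \<phi>
  for scale :: "'k::field_char_0 \<Rightarrow> 'a::ab_group_add \<Rightarrow> 'a" (infixr \<open>*s\<close> 75)
    and Basis and circ (infixl \<open>\<cdot>\<close> 70) and P
    and scaleV :: "'k \<Rightarrow> 'v::ab_group_add \<Rightarrow> 'v" and V and \<rho> \<phi> +
  fixes \<alpha> :: "'v \<Rightarrow> 'v"
  assumes alpha_endo: "linear_on_space scaleV scaleV V V \<alpha>"
    and rho_alpha:
      "v \<in> V \<Longrightarrow> \<rho> (P x) (\<alpha> v) = \<alpha> (\<rho> (P x) v)"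
      "v \<in> V \<Longrightarrow> \<alpha> (\<rho> (P x) v) = \<alpha> (\<rho> x (\<alpha> v))"
    and phi_alpha:
      "v \<in> V \<Longrightarrow> \<phi> (P x) (\<alpha> v) = \<alpha> (\<phi> (P x) v)"
      "v \<in> V \<Longrightarrow> \<alpha> (\<phi> (P x) v) = \<alpha> (\<phi> x (\<alpha> v))"

locale relative_rota_baxter_operator =
  averaging_representation scale Basis circ P scaleV V \<rho> \<phi> \<alpha>
  for scale :: "'k::field_char_0 \<Rightarrow> 'a::ab_group_add \<Rightarrow> 'a" (infixr \<open>*s\<close> 75)
    and Basis and circ (infixl \<open>\<cdot>\<close> 70) and P
    and scaleV :: "'k \<Rightarrow> 'v::ab_group_add \<Rightarrow> 'v" and V and \<rho> \<phi> and \<alpha> +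
  fixes T :: "'v \<Rightarrow> 'a"
  assumes linear_T: "linear_on_space scaleV scale V UNIV T"
    and rota_baxter:
      "u \<in> V \<Longrightarrow> v \<in> V \<Longrightarrow> T u \<cdot> T v = T (\<rho> (T u) v + \<phi> (T v) u)"
    and P_T: "v \<in> V \<Longrightarrow> P (T v) = T (\<alpha> v)"


section \<open>The dual space\<close>

definition dual_space :: "('k::field \<Rightarrow> 'a::ab_group_add \<Rightarrow> 'a) \<Rightarrow> ('a \<Rightarrow> 'k) set" where
  "dual_space scale = {f. Vector_Spaces.linear scale (*) f}"

definition dual_scale :: "'k::field \<Rightarrow> ('a \<Rightarrow> 'k) \<Rightarrow> 'a \<Rightarrow> 'k" where
  "dual_scale c f = (\<lambda>x. c * f x)"

definition dual_action :: "('a \<Rightarrow> 'v \<Rightarrow> 'v) \<Rightarrow> 'a \<Rightarrow> ('v \<Rightarrow> 'k::field) \<Rightarrow> 'v \<Rightarrow> 'k" where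
  "dual_action \<rho> x f = (\<lambda>v. - f (\<rho> x v))"

definition transpose_map :: "('v \<Rightarrow> 'v) \<Rightarrow> ('v \<Rightarrow> 'k::field) \<Rightarrow> 'v \<Rightarrow> 'k" where
  "transpose_map S f = (\<lambda>v. f (S v))"

definition left_mult :: "('a \<Rightarrow> 'a \<Rightarrow> 'a) \<Rightarrow> 'a \<Rightarrow> 'a \<Rightarrow> 'a" where
  "left_mult circ x y = circ x y"

definition right_mult :: "('a \<Rightarrow> 'a \<Rightarrow> 'a) \<Rightarrow> 'a \<Rightarrow> 'a \<Rightarrow> 'a" where
  "right_mult circ x y = circ y x"


section \<open>Tensor products\<close>

text \<open>The tensor products \<open>A \<otimes> A\<close> and \<open>A \<otimes> A \<otimes> A\<close> are quotients of the free vector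
  spaces on \<open>A \<times> A\<close> and \<open>A \<times> A \<times> A\<close> by the span of the multilinearity relations. A tensor is
  a coset, that is, an element of the quotient set.\<close>

definition free_scale :: "'k::field \<Rightarrow> ('x \<Rightarrow>\<^sub>0 'k) \<Rightarrow> ('x \<Rightarrow>\<^sub>0 'k)" where
  "free_scale c p = Poly_Mapping.map ((*) c) p"

abbreviation gen :: "'x \<Rightarrow> ('x \<Rightarrow>\<^sub>0 'k::field)" where
  "gen x \<equiv> Poly_Mapping.single x 1"

definition bilinear_relations ::
    "('k::field \<Rightarrow> 'a::ab_group_add \<Rightarrow> 'a) \<Rightarrow> ('a \<times> 'a \<Rightarrow>\<^sub>0 'k) set" where
  "bilinear_relations scale =
     {gen (x + x', y) - gen (x, y) - gen (x', y) | x x' y. True} \<union>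
     {gen (x, y + y') - gen (x, y) - gen (x, y') | x y y'. True} \<union>
     {gen (scale c x, y) - free_scale c (gen (x, y)) | c x y. True} \<union>
     {gen (x, scale c y) - free_scale c (gen (x, y)) | c x y. True}"

definition trilinear_relations ::
    "('k::field \<Rightarrow> 'a::ab_group_add \<Rightarrow> 'a) \<Rightarrow> ('a \<times> 'a \<times> 'a \<Rightarrow>\<^sub>0 'k) set" where
  "trilinear_relations scale =
     {gen (x + x', y, z) - gen (x, y, z) - gen (x', y, z) | x x' y z. True} \<union>
     {gen (x, y + y', z) - gen (x, y, z) - gen (x, y', z) | x y y' z. True} \<union>
     {gen (x, y, z + z') - gen (x, y, z) - gen (x, y, z') | x y z z'. True} \<union>
     {gen (scale c x, y, z) - free_scale c (gen (x, y, z)) | c x y z. True} \<union>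
     {gen (x, scale c y, z) - free_scale c (gen (x, y, z)) | c x y z. True} \<union>
     {gen (x, y, scale c z) - free_scale c (gen (x, y, z)) | c x y z. True}"

definition tensor2_rel ::
    "('k::field \<Rightarrow> 'a::ab_group_add \<Rightarrow> 'a) \<Rightarrow> ('a \<times> 'a \<Rightarrow>\<^sub>0 'k) rel" where
  "tensor2_rel scale = {(p, q). p - q \<in> module.span free_scale (bilinear_relations scale)}"

definition tensor3_rel ::
    "('k::field \<Rightarrow> 'a::ab_group_add \<Rightarrow> 'a) \<Rightarrow> ('a \<times> 'a \<times> 'a \<Rightarrow>\<^sub>0 'k) rel" where
  "tensor3_rel scale = {(p, q). p - q \<in> module.span free_scale (trilinear_relations scale)}"

definition tensor2_space ::
    "('k::field \<Rightarrow> 'a::ab_group_add \<Rightarrow> 'a) \<Rightarrow> ('a \<times> 'a \<Rightarrow>\<^sub>0 'k) set set" where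
  "tensor2_space scale = UNIV // tensor2_rel scale"

definition tensor2 ::
    "('k::field \<Rightarrow> 'a::ab_group_add \<Rightarrow> 'a) \<Rightarrow> ('a \<times> 'a \<Rightarrow>\<^sub>0 'k) \<Rightarrow> ('a \<times> 'a \<Rightarrow>\<^sub>0 'k) set" where
  "tensor2 scale p = tensor2_rel scale `` {p}"

definition tensor3 ::
    "('k::field \<Rightarrow> 'a::ab_group_add \<Rightarrow> 'a) \<Rightarrow> ('a \<times> 'a \<times> 'a \<Rightarrow>\<^sub>0 'k) \<Rightarrow>
     ('a \<times> 'a \<times> 'a \<Rightarrow>\<^sub>0 'k) set" where
  "tensor3 scale p = tensor3_rel scale `` {p}"

text \<open>\<open>tensor_sum scale n a b\<close> is \<open>\<Sum>i<n. a i \<otimes> b i\<close>. Every tensor has this form, see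
  \<open>tensor2_space_cases\<close> below.\<close>

definition tensor_sum ::
    "('k::field \<Rightarrow> 'a::ab_group_add \<Rightarrow> 'a) \<Rightarrow> nat \<Rightarrow> (nat \<Rightarrow> 'a) \<Rightarrow> (nat \<Rightarrow> 'a) \<Rightarrow>
     ('a \<times> 'a \<Rightarrow>\<^sub>0 'k) set" where
  "tensor_sum scale n a b = tensor2 scale (\<Sum>i<n. gen (a i, b i))"

definition symmetric_tensor ::
    "('k::field \<Rightarrow> 'a::ab_group_add \<Rightarrow> 'a) \<Rightarrow> ('a \<times> 'a \<Rightarrow>\<^sub>0 'k) set \<Rightarrow> bool" where
  "symmetric_tensor scale r \<longleftrightarrow>
     (\<exists>n a b. r = tensor_sum scale n a b \<and> r = tensor_sum scale n b a)"

text \<open>On linear functionals the value below does not depend on the decomposition of \<open>r\<close>, see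
  \<open>r_sharp_tensor_sum\<close> below.\<close>

definition r_sharp ::
    "('k::field \<Rightarrow> 'a::ab_group_add \<Rightarrow> 'a) \<Rightarrow> ('a \<times> 'a \<Rightarrow>\<^sub>0 'k) set \<Rightarrow> ('a \<Rightarrow> 'k) \<Rightarrow> 'a" where
  "r_sharp scale r f =
     (THE v. \<exists>n a b. r = tensor_sum scale n a b \<and> v = (\<Sum>i<n. scale (f (a i)) (b i)))"


section \<open>The admissible classical Yang-Baxter equation\<close>

definition admissible_CYBE_solution ::
    "('k::field \<Rightarrow> 'a::ab_group_add \<Rightarrow> 'a) \<Rightarrow> ('a \<Rightarrow> 'a \<Rightarrow> 'a) \<Rightarrow> ('a \<Rightarrow> 'a) \<Rightarrow> ('a \<Rightarrow> 'a) \<Rightarrow>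
     ('a \<times> 'a \<Rightarrow>\<^sub>0 'k) set \<Rightarrow> bool" where
  "admissible_CYBE_solution scale circ P S r \<longleftrightarrow>
     r \<in> tensor2_space scale \<and>
     (\<forall>n a b. r = tensor_sum scale n a b \<longrightarrow>
        tensor3 scale (\<Sum>i<n. \<Sum>j<n.
            gen (a i, circ (b i) (a j), b j) + gen (a i, a j, circ (b i) (b j))) =
        tensor3 scale (\<Sum>i<n. \<Sum>j<n.
            gen (circ (a i) (a j), b i, b j) + gen (a i, a j, circ (b j) (b i))) \<and>
        tensor2 scale (\<Sum>i<n. gen (S (a i), b i) - gen (a i, P (b i))) = tensor2 scale 0 \<and>
        tensor2 scale (\<Sum>i<n. gen (P (a i), b i) - gen (a i, S (b i))) = tensor2 scale 0)"


section \<open>Tensors as sums, and well-definedness\<close>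

lemma lookup_free_scale: "Poly_Mapping.lookup (free_scale c p) x = c * Poly_Mapping.lookup p x"
  by (simp add: free_scale_def Poly_Mapping.map.rep_eq when_def)

lemma free_vector_space: "vector_space (free_scale :: 'k::field \<Rightarrow> ('x \<Rightarrow>\<^sub>0 'k) \<Rightarrow> _)"
  by standard
    (auto intro!: poly_mapping_eqI simp: lookup_free_scale lookup_add algebra_simps)

lemma free_scale_single:
  "free_scale c (Poly_Mapping.single x d) = Poly_Mapping.single x (c * d)"
  by (simp add: free_scale_def)

context
  fixes scale :: "'k::field \<Rightarrow> 'a::ab_group_add \<Rightarrow> 'a"
begin

interpretation F: vector_space "free_scale :: 'k \<Rightarrow> ('a \<times> 'a \<Rightarrow>\<^sub>0 'k) \<Rightarrow> _"
  by (rule free_vector_space)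

lemma equiv_tensor2_rel: "equiv UNIV (tensor2_rel scale)"
proof (rule equivI)
  show "sym (tensor2_rel scale)"
    unfolding tensor2_rel_def sym_def by (auto dest: F.span_neg)
  show "trans (tensor2_rel scale)"
    unfolding tensor2_rel_def trans_def
    using F.span_add by fastforce
qed (auto simp: tensor2_rel_def refl_on_def F.span_zero)

lemma tensor2_eq_iff:
  "tensor2 scale p = tensor2 scale q \<longleftrightarrow>
   p - q \<in> module.span free_scale (bilinear_relations scale)"
  using eq_equiv_class_iff[OF equiv_tensor2_rel, of p q]
  by (simp add: tensor2_def) (simp add: tensor2_rel_def)

lemma tensor2_space_cases:
  assumes "r \<in> tensor2_space scale"
  obtains n a b where "r = tensor_sum scale n a b"
proof -
  have "\<exists>(n::nat) a b. p - (\<Sum>i<n. gen (a i, b i)) \<in> F.span (bilinear_relations scale)"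
    for p :: "'a \<times> 'a \<Rightarrow>\<^sub>0 'k"
  proof (induction p rule: update_induct)
    case const
    show ?case
      by (intro exI[where x = "0::nat"] exI[where x = "\<lambda>_. 0"]) (simp add: F.span_zero)
  next
    case (update p k c)
    then obtain n :: nat and a b
      where IH: "p - (\<Sum>i<n. gen (a i, b i)) \<in> F.span (bilinear_relations scale)"
      by blast
    obtain u v where k: "k = (u, v)" by (cases k)
    define a' where "a' = a(n := scale c u)"
    define b' where "b' = b(n := v)"
    have lookup_k: "Poly_Mapping.lookup p k = 0"
      using update.hyps(1) by (metis in_keys_iff)
    have upd: "Poly_Mapping.update k c p = p + Poly_Mapping.single k c"
      using lookup_k
      by (auto intro!: poly_mapping_eqI simp: lookup_update lookup_add lookup_single when_def)
    have "gen (scale c u, v) - free_scale c (gen (u, v)) \<in> bilinear_relations scale"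
      unfolding bilinear_relations_def by blast
    then have "gen (scale c u, v) - Poly_Mapping.single (u, v) c
        \<in> F.span (bilinear_relations scale)"
      by (simp add: F.span_base free_scale_single)
    from F.span_diff[OF IH this]
    have "p + Poly_Mapping.single k c - (\<Sum>i<Suc n. gen (a' i, b' i))
        \<in> F.span (bilinear_relations scale)"
      by (simp add: a'_def b'_def k algebra_simps)
    then show ?case unfolding upd by blast
  qed
  moreover obtain p where "r = tensor2 scale p"
    using assms by (auto simp: tensor2_space_def tensor2_def elim!: quotientE)
  ultimately show thesis
    using that by (metis tensor2_eq_iff tensor_sum_def)
qed

lemma r_sharp_tensor_sum:
  assumes "vector_space scale" and f: "f \<in> dual_space scale"
  shows "r_sharp scale (tensor_sum scale n a b) f = (\<Sum>i<n. scale (f (a i)) (b i))"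
proof -
  interpret A: vector_space scale by fact
  interpret f: Vector_Spaces.linear scale "(*)" f
    using f by (simp add: dual_space_def)
  define E where
    "E p = (\<Sum>k\<in>Poly_Mapping.keys p. scale (Poly_Mapping.lookup p k * f (fst k)) (snd k))"
    for p :: "'a \<times> 'a \<Rightarrow>\<^sub>0 'k"
  have E_sup: "E p = (\<Sum>k\<in>K. scale (Poly_Mapping.lookup p k * f (fst k)) (snd k))"
    if "finite K" "Poly_Mapping.keys p \<subseteq> K" for p K
    unfolding E_def using that
    by (intro sum.mono_neutral_left) (use in_keys_iff in fastforce)+
  have E_add: "E (p + q) = E p + E q" for p q
  proof -
    have "Poly_Mapping.keys (p + q) \<subseteq> Poly_Mapping.keys p \<union> Poly_Mapping.keys q" by (rule keys_add)
    then show ?thesis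
      by (simp add: E_sup[of "Poly_Mapping.keys p \<union> Poly_Mapping.keys q"] lookup_add sum.distrib
          A.scale_left_distrib distrib_right)
  qed
  have E_scale: "E (free_scale c p) = scale c (E p)" for c p
  proof -
    have "Poly_Mapping.keys (free_scale c p) \<subseteq> Poly_Mapping.keys p"
      using in_keys_iff lookup_free_scale by (metis mult_zero_right subsetI)
    then have "E (free_scale c p) =
        (\<Sum>k\<in>Poly_Mapping.keys p. scale c (scale (Poly_Mapping.lookup p k * f (fst k)) (snd k)))"
      by (subst E_sup[OF finite_keys]) (simp_all only: lookup_free_scale A.scale_scale mult.assoc)
    also have "\<dots> = scale c (E p)"
      by (simp only: E_def A.scale_sum_right)
    finally show ?thesis .
  qed
  interpret E: Vector_Spaces.linear free_scale scale E
    by unfold_locales (simp_all add: E_add E_scale)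
  have E_gen: "E (gen (x, y)) = scale (f x) y" for x y
    by (simp add: E_def)
  have "E p = 0" if "p \<in> F.span (bilinear_relations scale)" for p
  proof -
    have "bilinear_relations scale \<subseteq> {p. E p = 0}"
      by (auto simp: bilinear_relations_def E.diff E_gen E_scale f.add f.scale
          A.scale_left_distrib A.scale_right_distrib mult.commute)
    moreover have "F.subspace {p. E p = 0}"
      by (rule E.subspace_kernel)
    ultimately show ?thesis
      using that F.span_minimal by blast
  qed
  then have E_eq: "E p = E q" if "tensor2 scale p = tensor2 scale q" for p q
    using that by (metis E.diff eq_iff_diff_eq_0 tensor2_eq_iff)
  have E_sum: "E (\<Sum>i<m. gen (a i, b i)) = (\<Sum>i<m. scale (f (a i)) (b i))" for m :: nat and a b
    by (simp add: E.sum E_gen)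
  show ?thesis
    unfolding r_sharp_def
  proof (rule the_equality)
    fix v
    assume "\<exists>m a' b'. tensor_sum scale n a b = tensor_sum scale m a' b' \<and>
      v = (\<Sum>i<m. scale (f (a' i)) (b' i))"
    then show "v = (\<Sum>i<n. scale (f (a i)) (b i))"
      by (metis E_eq E_sum tensor_sum_def)
  qed blast
qed

end

end

theory Submission
  imports Defs
begin

text \<open>Write \<open>T = r\<^sup>\<sharp>\<close>. Symmetry of \<open>r\<close> means \<open>g (T f) = f (T g)\<close> for all functionals \<open>f, g\<close>. Pairing
  the Rota-Baxter identity for \<open>f, g\<close> with a functional \<open>h\<close> therefore gives
  \<open>h (T f \<cdot> T g) = g (T h \<cdot> T f) + f (T h \<cdot> T g) - g (T f \<cdot> T h)\<close>.
  The first two terms on the right are symmetric in \<open>f, g\<close> as a sum, and antisymmetrising in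
  \<open>f, g\<close> leaves exactly the Yang-Baxter equation evaluated at \<open>f \<otimes> g \<otimes> h\<close>. Since product
  functionals separate tensors, this suffices. The two operator equations are
  \<open>P \<circ> T = T \<circ> S\<^sup>*\<close> and its transpose.\<close>

section \<open>Linear extension of functions on generators to free vector spaces\<close>

definition free_lift :: "('x \<Rightarrow> 'k::field) \<Rightarrow> ('x \<Rightarrow>\<^sub>0 'k) \<Rightarrow> 'k" where
  "free_lift \<phi> p = (\<Sum>k\<in>Poly_Mapping.keys p. Poly_Mapping.lookup p k * \<phi> k)"

lemma free_lift_superset:
  assumes "finite K" "Poly_Mapping.keys p \<subseteq> K"
  shows "free_lift \<phi> p = (\<Sum>k\<in>K. Poly_Mapping.lookup p k * \<phi> k)"
  unfolding free_lift_def using assms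
  by (intro sum.mono_neutral_left) (auto simp: in_keys_iff)

lemma free_lift_gen [simp]: "free_lift \<phi> (gen x) = \<phi> x"
  by (simp add: free_lift_def)

lemma free_lift_add: "free_lift \<phi> (p + q) = free_lift \<phi> p + free_lift \<phi> q"
proof -
  have "Poly_Mapping.keys (p + q) \<subseteq> Poly_Mapping.keys p \<union> Poly_Mapping.keys q"
    by (rule keys_add)
  then show ?thesis
    by (simp add: free_lift_superset[of "Poly_Mapping.keys p \<union> Poly_Mapping.keys q"]
        lookup_add sum.distrib distrib_right)
qed

lemma free_lift_diff: "free_lift \<phi> (p - q) = free_lift \<phi> p - free_lift \<phi> q"
  using free_lift_add[of \<phi> "p - q" q] by simp

lemma free_lift_sum: "free_lift \<phi> (\<Sum>i\<in>I. p i) = (\<Sum>i\<in>I. free_lift \<phi> (p i))"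
  by (induction I rule: infinite_finite_induct)
    (simp_all add: free_lift_add, simp_all add: free_lift_def)

lemma poly_mapping_sum_gen:
  "p = (\<Sum>k\<in>Poly_Mapping.keys p. free_scale (Poly_Mapping.lookup p k) (gen k))"
  by (rule poly_mapping_eqI)
    (auto simp: lookup_sum free_scale_single lookup_single when_def in_keys_iff sum.delta)

text \<open>Modulo \<open>R\<close> each generator \<open>k\<close> is a combination of the
  \<open>gen (\<gamma> b)\<close> with coefficients \<open>\<phi> b k\<close>. Extending linearly,
  \<open>p\<close> is congruent to the combination with coefficients
  \<open>free_lift (\<phi> b) p\<close>, all of which vanish.\<close>

lemma span_if_free_lift_zero:
  fixes p :: "'x \<Rightarrow>\<^sub>0 'k::field"
  assumes gen: "\<And>k. gen k - (\<Sum>b\<in>C. free_scale (\<phi> b k) (gen (\<gamma> b))) \<in> module.span free_scale R"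
    and zero: "\<And>b. b \<in> C \<Longrightarrow> free_lift (\<phi> b) p = 0"
  shows "p \<in> module.span free_scale R"
proof -
  interpret F: vector_space "free_scale :: 'k \<Rightarrow> ('x \<Rightarrow>\<^sub>0 'k) \<Rightarrow> _"
    by (rule free_vector_space)
  let ?c = "Poly_Mapping.lookup p" and ?K = "Poly_Mapping.keys p"
  have "(\<Sum>k\<in>?K. free_scale (?c k) (\<Sum>b\<in>C. free_scale (\<phi> b k) (gen (\<gamma> b))))
      = (\<Sum>b\<in>C. \<Sum>k\<in>?K. free_scale (?c k * \<phi> b k) (gen (\<gamma> b)))"
    unfolding F.scale_sum_right F.scale_scale by (rule sum.swap)
  also have "\<dots> = (\<Sum>b\<in>C. free_scale (free_lift (\<phi> b) p) (gen (\<gamma> b)))"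
    by (simp only: free_lift_def F.scale_sum_left)
  also have "\<dots> = 0"
    by (simp add: zero)
  \<comment> \<open>The double sum being zero, subtracting it from the expansion of \<open>p\<close>
    in generators changes nothing and makes every term a multiple of an element of the span.\<close>
  finally have "p = (\<Sum>k\<in>?K. free_scale (?c k)
      (gen k - (\<Sum>b\<in>C. free_scale (\<phi> b k) (gen (\<gamma> b)))))"
    using poly_mapping_sum_gen[of p]
    by (simp only: F.scale_right_diff_distrib sum_subtractf diff_zero)
  also have "\<dots> \<in> F.span R"
    by (intro F.span_sum F.span_scale gen)
  finally show ?thesis .
qed

section \<open>Functionals, coordinates and the separation of tensors\<close>

lemma dual_spaceI:
  assumes "vector_space scale" "\<And>x y. f (x + y) = f x + f y" "\<And>c x. f (scale c x) = c * f x"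
  shows "f \<in> dual_space scale"
proof -
  interpret vector_space scale by fact
  show ?thesis
    unfolding dual_space_def mem_Collect_eq
    by unfold_locales (simp_all add: assms algebra_simps)
qed

lemma dual_space_add:
  assumes "f \<in> dual_space scale" "g \<in> dual_space scale"
  shows "f + g \<in> dual_space scale"
proof -
  interpret f: Vector_Spaces.linear scale "(*)" f
    using assms by (simp add: dual_space_def)
  interpret g: Vector_Spaces.linear scale "(*)" g
    using assms by (simp add: dual_space_def)
  show ?thesis
    by (rule dual_spaceI)
      (simp_all add: f.vs1.vector_space_axioms f.add g.add f.scale g.scale algebra_simps)
qed

context finite_dimensional_vector_space
begin

abbreviation coord :: "'b \<Rightarrow> 'b \<Rightarrow> 'a" where
  "coord b x \<equiv> representation Basis x b"

lemma coord_dual: "coord b \<in> dual_space scale"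
  by (rule dual_spaceI)
    (simp_all add: vector_space_axioms representation_add representation_scale
      independent_Basis span_Basis)

lemma coord_expansion: "(\<Sum>b\<in>Basis. scale (coord b x) b) = x"
  by (rule sum_representation_eq) (simp_all add: independent_Basis span_Basis finite_Basis)

lemma dual_separates:
  assumes "\<And>f. f \<in> dual_space scale \<Longrightarrow> f x = f y"
  shows "x = y"
proof -
  have "coord b x = coord b y" for b
    by (rule assms[OF coord_dual])
  then have "(\<Sum>b\<in>Basis. scale (coord b x) b) = (\<Sum>b\<in>Basis. scale (coord b y) b)"
    by simp
  then show ?thesis
    by (simp only: coord_expansion)
qed

text \<open>Treats one slot of a tensor: \<open>q\<close> will be \<open>gen\<close> with the other
  slots fixed, which is linear only modulo the relations.\<close>

lemma coord_expansion_mod: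
  fixes q :: "'b \<Rightarrow> ('x \<Rightarrow>\<^sub>0 'a)"
  assumes add: "\<And>x y. q (x + y) - q x - q y \<in> module.span free_scale R"
    and scl: "\<And>c x. q (scale c x) - free_scale c (q x) \<in> module.span free_scale R"
  shows "q x - (\<Sum>b\<in>Basis. free_scale (coord b x) (q b)) \<in> module.span free_scale R"
proof -
  interpret F: vector_space "free_scale :: 'a \<Rightarrow> ('x \<Rightarrow>\<^sub>0 'a) \<Rightarrow> _"
    by (rule free_vector_space)
  have zero: "q 0 \<in> F.span R"
    using scl[of 0 0] by simp
  \<comment> \<open>Arbitrary coefficients and an arbitrary finite set of vectors make the induction
    possible; the coordinates on \<open>Basis\<close> are put in afterwards.\<close>
  have "q (\<Sum>b\<in>B. scale (c b) b) - (\<Sum>b\<in>B. free_scale (c b) (q b)) \<in> F.span R"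
    if "finite B" for B c
    using that
  proof induction
    case empty
    then show ?case using zero by simp
  next
    case (insert b B)
    let ?s = "\<Sum>b\<in>B. scale (c b) b"
    \<comment> \<open>The errors of additivity, of homogeneity and of the induction hypothesis
      telescope to the required difference.\<close>
    have "(q (scale (c b) b + ?s) - q (scale (c b) b) - q ?s)
        + (q (scale (c b) b) - free_scale (c b) (q b))
        + (q ?s - (\<Sum>b\<in>B. free_scale (c b) (q b))) \<in> F.span R"
      by (intro F.span_add add scl insert.IH)
    then show ?case
      using insert.hyps by (simp add: algebra_simps)
  qed
  from this[OF finite_Basis, of "\<lambda>b. coord b x"] show ?thesis
    by (simp add: coord_expansion)
qed

text \<open>Expanding both slots in the basis leaves \<open>gen (b, c)\<close> with coefficient
  \<open>coord b x * coord c y\<close>. This is a product of functionals in \<open>(x, y)\<close>,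
  so products of coordinates already suffice as tests.\<close>

lemma span_bilinear_relations_if:
  assumes "\<And>f g. f \<in> dual_space scale \<Longrightarrow> g \<in> dual_space scale \<Longrightarrow>
    free_lift (\<lambda>(x, y). f x * g y) p = 0"
  shows "p \<in> module.span free_scale (bilinear_relations scale)"
proof (rule span_if_free_lift_zero)
  interpret F: vector_space "free_scale :: 'a \<Rightarrow> ('b \<times> 'b \<Rightarrow>\<^sub>0 'a) \<Rightarrow> _"
    by (rule free_vector_space)
  let ?R = "bilinear_relations scale"
  fix k :: "'b \<times> 'b"
  obtain x y where k: "k = (x, y)" by (cases k)
  have 1: "gen (x, y) - (\<Sum>b\<in>Basis. free_scale (coord b x) (gen (b, y))) \<in> F.span ?R" for x y
    by (rule coord_expansion_mod[where q = "\<lambda>x. gen (x, y)"];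
        rule F.span_base; unfold bilinear_relations_def; blast)
  have 2: "gen (x, y) - (\<Sum>c\<in>Basis. free_scale (coord c y) (gen (x, c))) \<in> F.span ?R" for x y
    by (rule coord_expansion_mod[where q = "\<lambda>y. gen (x, y)"];
        rule F.span_base; unfold bilinear_relations_def; blast)
  \<comment> \<open>Expand the first slot, then the second slot inside each resulting term; the
    intermediate \<open>gen (b, y)\<close> cancel.\<close>
  have "(gen (x, y) - (\<Sum>b\<in>Basis. free_scale (coord b x) (gen (b, y))))
      + (\<Sum>b\<in>Basis. free_scale (coord b x)
          (gen (b, y) - (\<Sum>c\<in>Basis. free_scale (coord c y) (gen (b, c))))) \<in> F.span ?R"
    by (intro F.span_add F.span_sum F.span_scale 1 2)
  then show "gen k - (\<Sum>b\<in>Basis \<times> Basis. free_scale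
      ((case b of (b, c) \<Rightarrow> \<lambda>(x, y). coord b x * coord c y) k) (gen b)) \<in> F.span ?R"
    by (simp add: k F.scale_right_diff_distrib sum_subtractf F.scale_sum_right
        sum.cartesian_product split_def)
qed (auto intro!: assms coord_dual)

text \<open>The slots are again expanded one after the other, now with three nested
  expansions.\<close>

lemma span_trilinear_relations_if:
  assumes "\<And>f g h. f \<in> dual_space scale \<Longrightarrow> g \<in> dual_space scale \<Longrightarrow> h \<in> dual_space scale \<Longrightarrow>
    free_lift (\<lambda>(x, y, z). f x * g y * h z) p = 0"
  shows "p \<in> module.span free_scale (trilinear_relations scale)"
proof (rule span_if_free_lift_zero)
  interpret F: vector_space "free_scale :: 'a \<Rightarrow> ('b \<times> 'b \<times> 'b \<Rightarrow>\<^sub>0 'a) \<Rightarrow> _"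
    by (rule free_vector_space)
  let ?R = "trilinear_relations scale"
  fix k :: "'b \<times> 'b \<times> 'b"
  obtain x y z where k: "k = (x, y, z)" by (cases k)
  have 1: "gen (x, y, z) - (\<Sum>b\<in>Basis. free_scale (coord b x) (gen (b, y, z))) \<in> F.span ?R"
    for x y z
    by (rule coord_expansion_mod[where q = "\<lambda>x. gen (x, y, z)"];
        rule F.span_base; unfold trilinear_relations_def Un_iff mem_Collect_eq; metis)
  have 2: "gen (x, y, z) - (\<Sum>c\<in>Basis. free_scale (coord c y) (gen (x, c, z))) \<in> F.span ?R"
    for x y z
    by (rule coord_expansion_mod[where q = "\<lambda>y. gen (x, y, z)"];
        rule F.span_base; unfold trilinear_relations_def Un_iff mem_Collect_eq; metis)
  have 3: "gen (x, y, z) - (\<Sum>d\<in>Basis. free_scale (coord d z) (gen (x, y, d))) \<in> F.span ?R"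
    for x y z
    by (rule coord_expansion_mod[where q = "\<lambda>z. gen (x, y, z)"];
        rule F.span_base; unfold trilinear_relations_def Un_iff mem_Collect_eq; metis)
  have "(gen (x, y, z) - (\<Sum>b\<in>Basis. free_scale (coord b x) (gen (b, y, z))))
      + (\<Sum>b\<in>Basis. free_scale (coord b x)
          ((gen (b, y, z) - (\<Sum>c\<in>Basis. free_scale (coord c y) (gen (b, c, z))))
          + (\<Sum>c\<in>Basis. free_scale (coord c y)
              (gen (b, c, z) - (\<Sum>d\<in>Basis. free_scale (coord d z) (gen (b, c, d)))))))
      \<in> F.span ?R"
    by (intro F.span_add F.span_sum F.span_scale 1 2 3)
  then show "gen k - (\<Sum>b\<in>Basis \<times> Basis \<times> Basis. free_scale
      ((case b of (b, c, d) \<Rightarrow> \<lambda>(x, y, z). coord b x * coord c y * coord d z) k) (gen b))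
      \<in> F.span ?R"
    by (simp add: k F.scale_right_diff_distrib sum_subtractf F.scale_sum_right
        sum.cartesian_product split_def mult.assoc)
qed (auto intro!: assms coord_dual)

end

section \<open>Symmetric tensors and the Yang-Baxter equation\<close>

lemma tensor3_eqI:
  fixes scale :: "'k::field \<Rightarrow> 'a::ab_group_add \<Rightarrow> 'a"
  assumes "p - q \<in> module.span free_scale (trilinear_relations scale)"
  shows "tensor3 scale p = tensor3 scale q"
proof -
  interpret F: vector_space "free_scale :: 'k \<Rightarrow> ('a \<times> 'a \<times> 'a \<Rightarrow>\<^sub>0 'k) \<Rightarrow> _"
    by (rule free_vector_space)
  have "p - x \<in> F.span (trilinear_relations scale) \<longleftrightarrow>
      q - x \<in> F.span (trilinear_relations scale)" for x
    using F.span_add_eq[OF assms, of "q - x"] by simp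
  then show ?thesis
    by (auto simp: tensor3_def tensor3_rel_def)
qed

text \<open>\<open>r_sharp\<close> may be computed from any decomposition. Using \<open>a, b\<close>
  for \<open>f\<close> and the swapped one for \<open>g\<close> turns both sides into the sum of
  \<open>f (a i) * g (b i)\<close>.\<close>

lemma r_sharp_symmetric:
  assumes V: "vector_space scale" and "symmetric_tensor scale r"
    and f: "f \<in> dual_space scale" and g: "g \<in> dual_space scale"
  shows "g (r_sharp scale r f) = f (r_sharp scale r g)"
proof -
  obtain n a b where r: "r = tensor_sum scale n a b" "r = tensor_sum scale n b a"
    using assms(2) by (auto simp: symmetric_tensor_def)
  interpret f: Vector_Spaces.linear scale "(*)" f
    using f by (simp add: dual_space_def)
  interpret g: Vector_Spaces.linear scale "(*)" g
    using g by (simp add: dual_space_def)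
  have "r_sharp scale r f = (\<Sum>i<n. scale (f (a i)) (b i))"
    unfolding r(1) by (rule r_sharp_tensor_sum[OF V f])
  moreover have "r_sharp scale r g = (\<Sum>i<n. scale (g (b i)) (a i))"
    unfolding r(2) by (rule r_sharp_tensor_sum[OF V g])
  ultimately show ?thesis
    by (simp add: f.sum g.sum f.scale g.scale mult.commute)
qed

theorem proposition4p11:
  fixes scale :: "'k::field_char_0 \<Rightarrow> 'a::ab_group_add \<Rightarrow> 'a"
    and Basis :: "'a set"
    and circ :: "'a \<Rightarrow> 'a \<Rightarrow> 'a"
    and P S :: "'a \<Rightarrow> 'a"
    and r :: "('a \<times> 'a \<Rightarrow>\<^sub>0 'k) set"
  assumes "averaging_pre_lie_algebra scale Basis circ P"
    and "r \<in> tensor2_space scale"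
    and "symmetric_tensor scale r"
    and "Vector_Spaces.linear scale scale S"
    and "relative_rota_baxter_operator scale Basis circ P
           dual_scale (dual_space scale)
           (\<lambda>x. dual_action (left_mult circ) x - dual_action (right_mult circ) x)
           (\<lambda>x. - dual_action (right_mult circ) x)
           (transpose_map S) (r_sharp scale r)"
  shows "admissible_CYBE_solution scale circ P S r"
proof -
  let ?D = "dual_space scale"
  define T where "T = r_sharp scale r"
  interpret A: averaging_pre_lie_algebra scale Basis circ P by fact
  interpret RB: relative_rota_baxter_operator scale Basis circ P dual_scale ?D
    "\<lambda>x. dual_action (left_mult circ) x - dual_action (right_mult circ) x"
    "\<lambda>x. - dual_action (right_mult circ) x" "transpose_map S" "r_sharp scale r"
    by fact
  interpret P: Vector_Spaces.linear scale scale P by (rule A.linear_P)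
  interpret S: Vector_Spaces.linear scale scale S by fact
  interpret circ_right: Vector_Spaces.linear scale scale "\<lambda>y. circ x y" for x
    by (rule A.linear_circ_right)
  interpret circ_left: Vector_Spaces.linear scale scale "\<lambda>x. circ x y" for y
    by (rule A.linear_circ_left)
  have dual_sum: "f (\<Sum>i\<in>I. x i) = (\<Sum>i\<in>I. f (x i))" and dual_scale: "f (scale c y) = c * f y"
    if "f \<in> ?D" for f c y and x :: "nat \<Rightarrow> 'a" and I
  proof -
    interpret f: Vector_Spaces.linear scale "(*)" f
      using that by (simp add: dual_space_def)
    show "f (\<Sum>i\<in>I. x i) = (\<Sum>i\<in>I. f (x i))" "f (scale c y) = c * f y"
      by (simp_all add: f.sum f.scale)
  qed
  have dual_comp: "(\<lambda>x. f (E x)) \<in> ?D"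
    if "f \<in> ?D" "Vector_Spaces.linear scale scale E" for f E
    using Vector_Spaces.linear_compose[OF that(2), of "(*)" f] that(1)
    by (simp add: dual_space_def comp_def)
  have T_sym: "g (T f) = f (T g)" if "f \<in> ?D" "g \<in> ?D" for f g
    unfolding T_def using r_sharp_symmetric[OF A.vector_space_axioms assms(3) that] .
  have T_S: "P (T f) = T (\<lambda>x. f (S x))" if "f \<in> ?D" for f
    using RB.P_T[OF that] by (simp add: T_def transpose_map_def)
  have T_circ: "h (circ (T f) (T g)) = g (circ (T h) (T f)) + f (circ (T h) (T g))
      - g (circ (T f) (T h))"
    if f: "f \<in> ?D" and g: "g \<in> ?D" and h: "h \<in> ?D" for f g h
  proof -
    \<comment> \<open>\<open>?w\<close> is the argument of \<open>T\<close> on the right of the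
      Rota-Baxter identity. It must be shown to be a functional before \<open>T_sym\<close> can move
      \<open>T\<close> from \<open>?w\<close> to \<open>h\<close>; the signs in
      \<open>dual_action\<close> then give the three terms.\<close>
    let ?w = "(dual_action (left_mult circ) (T f) - dual_action (right_mult circ) (T f)) g
        + (- dual_action (right_mult circ) (T g)) f"
    have "?w \<in> ?D"
    proof -
      have "(dual_action (left_mult circ) (T f) - dual_action (right_mult circ) (T f)) g \<in> ?D"
        using RB.rho_endo[of "T f"] g by (auto simp: linear_on_space_def)
      moreover have "(- dual_action (right_mult circ) (T g)) f \<in> ?D"
        using RB.phi_endo[of "T g"] f by (auto simp: linear_on_space_def)
      ultimately show ?thesis
        by (rule dual_space_add)
    qed
    then have "h (T ?w) = ?w (T h)"
      using T_sym h by blast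
    then show ?thesis
      using RB.rota_baxter[OF f g]
      by (simp add: T_def dual_action_def left_mult_def right_mult_def)
  qed
  show ?thesis
    unfolding admissible_CYBE_solution_def
  proof (intro conjI allI impI assms(2))
    fix n a b
    assume r: "r = tensor_sum scale n a b"
    have T: "T f = (\<Sum>i<n. scale (f (a i)) (b i))" if "f \<in> ?D" for f
      unfolding T_def r by (rule r_sharp_tensor_sum[OF A.vector_space_axioms that])
    \<comment> \<open>The decomposition at hand is arbitrary, so the sum with swapped
      \<open>a\<close> and \<open>b\<close> need not represent \<open>r\<close> by construction; the
      formula follows from \<open>T_sym\<close> by testing on functionals.\<close>
    have T': "T f = (\<Sum>i<n. scale (f (b i)) (a i))" if f: "f \<in> ?D" for f
    proof (rule A.dual_separates)
      fix g assume g: "g \<in> ?D"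
      show "g (T f) = g (\<Sum>i<n. scale (f (b i)) (a i))"
        unfolding T_sym[OF f g] T[OF g]
        by (simp add: dual_sum f g dual_scale mult.commute)
    qed
    have pair: "g (T f) = (\<Sum>i<n. f (a i) * g (b i))" if "f \<in> ?D" "g \<in> ?D" for f g
      using that by (simp add: T dual_sum dual_scale)
    show "tensor2 scale (\<Sum>i<n. gen (S (a i), b i) - gen (a i, P (b i))) = tensor2 scale 0"
      unfolding tensor2_eq_iff diff_zero
    proof (rule A.span_bilinear_relations_if)
      fix f g assume fg: "f \<in> ?D" "g \<in> ?D"
      show "free_lift (\<lambda>(x, y). f x * g y)
          (\<Sum>i<n. gen (S (a i), b i) - gen (a i, P (b i))) = 0"
        \<comment> \<open>Apply \<open>g\<close> to \<open>P (T f) = T (f o S)\<close>: the two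
          instances of \<open>pair\<close>, with \<open>f o S\<close> and with \<open>g o P\<close>,
          evaluate the two sides.\<close>
        using T_S[OF fg(1)] pair[OF dual_comp[OF fg(1) assms(4)] fg(2)]
          pair[OF fg(1) dual_comp[OF fg(2) A.linear_P]]
        by (simp add: free_lift_sum free_lift_diff sum_subtractf)
    qed
    show "tensor2 scale (\<Sum>i<n. gen (P (a i), b i) - gen (a i, S (b i))) = tensor2 scale 0"
      unfolding tensor2_eq_iff diff_zero
    proof (rule A.span_bilinear_relations_if)
      fix f g assume fg: "f \<in> ?D" "g \<in> ?D"
      note Pf = dual_comp[OF fg(1) A.linear_P] and Sg = dual_comp[OF fg(2) assms(4)]
      \<comment> \<open>The chain is
        \<open>g (T (f o P)) = f (P (T g)) = f (T (g o S)) = g (S (T f))\<close>.\<close>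
      have "g (T (\<lambda>x. f (P x))) = g (S (T f))"
        using T_sym[OF Pf fg(2)] T_sym[OF fg(1) Sg] T_S[OF fg(2)] by simp
      then show "free_lift (\<lambda>(x, y). f x * g y)
          (\<Sum>i<n. gen (P (a i), b i) - gen (a i, S (b i))) = 0"
        using pair[OF Pf fg(2)] pair[OF fg(1) Sg]
        by (simp add: free_lift_sum free_lift_diff sum_subtractf)
    qed
    show "tensor3 scale (\<Sum>i<n. \<Sum>j<n.
            gen (a i, circ (b i) (a j), b j) + gen (a i, a j, circ (b i) (b j))) =
        tensor3 scale (\<Sum>i<n. \<Sum>j<n.
            gen (circ (a i) (a j), b i, b j) + gen (a i, a j, circ (b j) (b i)))"
    proof (rule tensor3_eqI, rule A.span_trilinear_relations_if)
      fix f g h assume D: "f \<in> ?D" "g \<in> ?D" "h \<in> ?D"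
      have circ_sum: "u (circ (\<Sum>i<n. scale (c i) (x i)) (\<Sum>j<n. scale (d j) (y j)))
          = (\<Sum>i<n. \<Sum>j<n. c i * d j * u (circ (x i) (y j)))"
        if "u \<in> ?D" for u c d x y
        by (simp add: circ_left.sum circ_right.sum circ_left.scale circ_right.scale
            dual_sum[OF that] dual_scale[OF that] mult_ac sum_distrib_left)
          (subst sum.swap, simp)
      \<comment> \<open>A functional applied to \<open>a\<close> leaves \<open>b\<close> in the
        product and calls for \<open>T\<close>; one applied to \<open>b\<close> leaves
        \<open>a\<close> and calls for \<open>T'\<close>. The same rule selects the expansions in
        the other three sums.\<close>
      have 1: "(\<Sum>i<n. \<Sum>j<n. f (a i) * g (circ (b i) (a j)) * h (b j)) = g (circ (T f) (T h))"
        unfolding T[OF D(1)] T'[OF D(3)] circ_sum[OF D(2)] by (simp add: mult_ac)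
      have 2: "(\<Sum>i<n. \<Sum>j<n. f (a i) * g (a j) * h (circ (b i) (b j))) = h (circ (T f) (T g))"
        unfolding T[OF D(1)] T[OF D(2)] circ_sum[OF D(3)] by (simp add: mult_ac)
      have 3: "(\<Sum>i<n. \<Sum>j<n. f (circ (a i) (a j)) * g (b i) * h (b j)) = f (circ (T g) (T h))"
        unfolding T'[OF D(2)] T'[OF D(3)] circ_sum[OF D(1)] by (simp add: mult_ac)
      have 4: "(\<Sum>i<n. \<Sum>j<n. f (a i) * g (a j) * h (circ (b j) (b i))) = h (circ (T g) (T f))"
        unfolding T[OF D(1)] T[OF D(2)] circ_sum[OF D(3)]
        \<comment> \<open>Here \<open>b j\<close> stands to the left of \<open>b i\<close>, so the
          summation order is exchanged to match \<open>circ (T g) (T f)\<close>.\<close>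
        by (subst sum.swap) (simp add: mult_ac)
      show "free_lift (\<lambda>(x, y, z). f x * g y * h z)
          ((\<Sum>i<n. \<Sum>j<n. gen (a i, circ (b i) (a j), b j) + gen (a i, a j, circ (b i) (b j))) -
           (\<Sum>i<n. \<Sum>j<n. gen (circ (a i) (a j), b i, b j) + gen (a i, a j, circ (b j) (b i)))) = 0"
        \<comment> \<open>\<open>T_circ\<close> is used for \<open>f, g, h\<close> and for
          \<open>g, f, h\<close>; the part symmetric in \<open>f\<close> and \<open>g\<close>
          cancels, and the remaining terms cancel sums 1 and 3.\<close>
        by (simp add: free_lift_sum free_lift_diff free_lift_add sum.distrib 1 2 3 4)
          (simp add: T_circ[OF D] T_circ[OF D(2,1,3)])
    qed
  qed
qed

end
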